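(* Let $\mathcal{E}\subset\otimes_{i=1}^{l}\mathbb{R}^{d_{i}}$ be an ellipsoid such that $$B_{2}^{d_{1}}\otimes_{\pi}\cdots\otimes_{\pi}B_{2}^{d_{l}}\subset\mathcal{E}\subset B_{2}^{d_{1}}\otimes_{\epsilon}\cdots\otimes_{\epsilon}B_{2}^{d_{l}}.$$ Then $\mathcal{E}=B_{2}^{d_{1},\ldots,d_{l}}$.
   Context: Here $l$ and $d_1,\dots,d_l$ are positive integers, and $\subset$ allows equality. $\langle\cdot,\cdot\rangle$ is the standard scalar product on $\mathbb{R}^{d}$ with closed unit ball $B_2^d$, and $\langle\cdot,\cdot\rangle_H$ is the scalar product on $\otimes_{i=1}^l\mathbb{R}^{d_i}$ determined by $\langle x^1\otimes\cdots\otimes x^l,y^1\otimes\cdots\otimes y^l\rangle_H=\prod_{i=1}^l\langle x^i,y^i\rangle$, with closed unit ball $B_2^{d_1,\ldots,d_l}$. A $0$-symmetric convex body is a compact convex set $P$ with nonempty interior and $P=-P$. The polar set of a nonempty $C$ in a Euclidean space $\mathbb{E}$ is $C^\circ=\{y\in\mathbb{E}:\sup_{x\in C}|\langle x,y\rangle_{\mathbb{E}}|\le 1\}$ (with $\langle\cdot,\cdot\rangle$ in $\mathbb{R}^{d_i}$ and $\langle\cdot,\cdot\rangle_H$ in the tensor product). For $0$-symmetric convex bodies $Q_i\subset\mathbb{R}^{d_i}$: $Q_1\otimes_\pi\cdots\otimes_\pi Q_l:=\mathrm{conv}\{x^1\otimes\cdots\otimes x^l:x^i\in Q_i,\ i=1,\dots,l\}$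 and $Q_1\otimes_\epsilon\cdots\otimes_\epsilon Q_l:=(Q_1^\circ\otimes_\pi\cdots\otimes_\pi Q_l^\circ)^\circ$. An ellipsoid in $\otimes_{i=1}^l\mathbb{R}^{d_i}$ is a set of the form $T(B_2^{d_1,\ldots,d_l})$ with $T:\otimes_{i=1}^l\mathbb{R}^{d_i}\to\otimes_{i=1}^l\mathbb{R}^{d_i}$ a linear isomorphism. *)

theory Defs
  imports "HOL-Analysis.Analysis" "HOL-Library.Function_Algebras"
begin

text \<open>The pointwise real vector space structure on functions, so that the library notions
  \<open>convex hull\<close>, \<open>span\<close> and \<open>linear\<close> apply to families of real numbers.\<close>

instantiation "fun" :: (type, real_vector) real_vector
begin

definition scaleR_fun :: "real \<Rightarrow> ('a \<Rightarrow> 'b) \<Rightarrow> 'a \<Rightarrow> 'b"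
  where "scaleR_fun c f = (\<lambda>x. c *\<^sub>R f x)"

instance
  by standard (auto simp: scaleR_fun_def fun_eq_iff scaleR_add_right scaleR_add_left)

end

lemma scaleR_fun_apply [simp]: "(c *\<^sub>R f) x = c *\<^sub>R f x"
  by (simp add: scaleR_fun_def)


text \<open>The Euclidean space of real families indexed by a finite set \<open>I\<close> is modelled by the
  functions that vanish outside \<open>I\<close>. Both the factors (\<open>I = {..<d}\<close>) and the tensor product
  (\<open>I\<close> a set of multi-indices) are of this form.\<close>

definition coord_space :: "'i set \<Rightarrow> ('i \<Rightarrow> real) set"
  where "coord_space I = {x. \<forall>i. i \<notin> I \<longrightarrow> x i = 0}"

definition dot :: "'i set \<Rightarrow> ('i \<Rightarrow> real) \<Rightarrow> ('i \<Rightarrow> real) \<Rightarrow> real"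
  where "dot I x y = (\<Sum>i\<in>I. x i * y i)"

definition unit_ball :: "'i set \<Rightarrow> ('i \<Rightarrow> real) set"
  where "unit_ball I = {x \<in> coord_space I. sqrt (dot I x x) \<le> 1}"

text \<open>The supremum is taken in the extended reals because it may be infinite.\<close>

definition polar :: "'i set \<Rightarrow> ('i \<Rightarrow> real) set \<Rightarrow> ('i \<Rightarrow> real) set"
  where "polar I C = {y \<in> coord_space I. (SUP x\<in>C. ereal \<bar>dot I x y\<bar>) \<le> 1}"


text \<open>With the factors numbered \<open>0, \<dots>, l - 1\<close>, the tensor product of the spaces
  \<open>coord_space {..<d i}\<close> is \<open>coord_space (multi_indices l d)\<close>; the lemmas \<open>dot_tensor\<close> and
  \<open>span_tensors\<close> below say that \<open>dot (multi_indices l d)\<close> is the scalar product determined by its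
  values on elementary tensors.\<close>

definition multi_indices :: "nat \<Rightarrow> (nat \<Rightarrow> nat) \<Rightarrow> (nat \<Rightarrow> nat) set"
  where "multi_indices l d = (\<Pi>\<^sub>E i\<in>{..<l}. {..<d i})"

definition tensor :: "nat \<Rightarrow> (nat \<Rightarrow> nat) \<Rightarrow> (nat \<Rightarrow> nat \<Rightarrow> real) \<Rightarrow> (nat \<Rightarrow> nat) \<Rightarrow> real"
  where "tensor l d x = (\<lambda>m. if m \<in> multi_indices l d then \<Prod>i<l. x i (m i) else 0)"

abbreviation tensor_space :: "nat \<Rightarrow> (nat \<Rightarrow> nat) \<Rightarrow> ((nat \<Rightarrow> nat) \<Rightarrow> real) set"
  where "tensor_space l d \<equiv> coord_space (multi_indices l d)"

lemma finite_multi_indices: "finite (multi_indices l d)"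
  by (simp add: multi_indices_def finite_PiE)

lemma dot_tensor:
  "dot (multi_indices l d) (tensor l d x) (tensor l d y) = (\<Prod>i<l. dot {..<d i} (x i) (y i))"
  by (simp add: dot_def tensor_def multi_indices_def prod_sum_PiE prod.distrib)

lemma span_tensors:
  "span {tensor l d x | x. \<forall>i<l. x i \<in> coord_space {..<d i}} = tensor_space l d"
    (is "span ?S = _")
proof
  have "subspace (tensor_space l d)"
    by (auto simp: subspace_def coord_space_def)
  moreover have "?S \<subseteq> tensor_space l d"
    by (auto simp: tensor_def coord_space_def)
  ultimately show "span ?S \<subseteq> tensor_space l d"
    by (rule span_minimal[rotated])
next
  define e where "e = (\<lambda>m. tensor l d (\<lambda>i j. if j = m i then 1 else 0))"
  have e_apply: "e m n = (if n = m then 1 else 0)"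
    if m: "m \<in> multi_indices l d" for m n
  proof (cases "n \<in> multi_indices l d \<and> n \<noteq> m")
    case True
    then obtain i where "i < l" "n i \<noteq> m i"
      using m unfolding multi_indices_def by (metis PiE_ext lessThan_iff)
    then have "(\<Prod>i<l. if n i = m i then 1 else 0 :: real) = 0"
      by (intro prod_zero) auto
    with True show ?thesis by (simp add: e_def tensor_def)
  next
    case False
    then consider "n = m" | "n \<notin> multi_indices l d" by blast
    then show ?thesis
    proof cases
      case 1
      with m show ?thesis by (simp add: e_def tensor_def)
    next
      case 2
      with m have "n \<noteq> m" by blast
      with 2 show ?thesis by (simp add: e_def tensor_def)
    qed
  qed
  have e_in: "e m \<in> ?S" if "m \<in> multi_indices l d" for m
  proof -
    have "\<forall>i<l. (\<lambda>j. if j = m i then 1 else 0) \<in> coord_space {..<d i}"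
      using that by (auto simp: multi_indices_def coord_space_def PiE_iff)
    then show ?thesis unfolding e_def by blast
  qed
  show "tensor_space l d \<subseteq> span ?S"
  proof
    fix u assume u: "u \<in> tensor_space l d"
    have sum_apply: "(\<Sum>m\<in>A. f m) n = (\<Sum>m\<in>A. f m n)"
      for A and f :: "(nat \<Rightarrow> nat) \<Rightarrow> (nat \<Rightarrow> nat) \<Rightarrow> real" and n
      by (induction A rule: infinite_finite_induct) auto
    have "u = (\<Sum>m\<in>multi_indices l d. u m *\<^sub>R e m)"
    proof
      fix n
      have "(\<Sum>m\<in>multi_indices l d. u m *\<^sub>R e m) n
          = (\<Sum>m\<in>multi_indices l d. if n = m then u m else 0)"
        unfolding sum_apply by (rule sum.cong) (auto simp: e_apply)
      also have "\<dots> = u n"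
        using u finite_multi_indices by (simp add: coord_space_def)
      finally show "u n = (\<Sum>m\<in>multi_indices l d. u m *\<^sub>R e m) n" ..
    qed
    also have "\<dots> \<in> span ?S"
      by (intro span_sum span_scale span_base e_in)
    finally show "u \<in> span ?S" .
  qed
qed


text \<open>\<open>Q\<^sub>1 \<otimes>\<^sub>\<pi> \<dots> \<otimes>\<^sub>\<pi> Q\<^sub>l\<close> and \<open>Q\<^sub>1 \<otimes>\<^sub>\<epsilon> \<dots> \<otimes>\<^sub>\<epsilon> Q\<^sub>l\<close>, for arbitrary sets \<open>Q\<^sub>i\<close>.\<close>

definition proj_prod :: "nat \<Rightarrow> (nat \<Rightarrow> nat) \<Rightarrow> (nat \<Rightarrow> (nat \<Rightarrow> real) set) \<Rightarrow> ((nat \<Rightarrow> nat) \<Rightarrow> real) set"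
  where "proj_prod l d Q = convex hull {tensor l d x | x. \<forall>i<l. x i \<in> Q i}"

definition inj_prod :: "nat \<Rightarrow> (nat \<Rightarrow> nat) \<Rightarrow> (nat \<Rightarrow> (nat \<Rightarrow> real) set) \<Rightarrow> ((nat \<Rightarrow> nat) \<Rightarrow> real) set"
  where "inj_prod l d Q = polar (multi_indices l d) (proj_prod l d (\<lambda>i. polar {..<d i} (Q i)))"

text \<open>The map \<open>T\<close> is linear on the whole ambient function space. This is no restriction, since a
  linear map on \<open>coord_space I\<close> extends by composing it with the coordinate projection onto
  \<open>coord_space I\<close>.\<close>

definition ellipsoid :: "'i set \<Rightarrow> ('i \<Rightarrow> real) set \<Rightarrow> bool"
  where "ellipsoid I E \<longleftrightarrow>
    (\<exists>T. linear T \<and> bij_betw T (coord_space I) (coord_space I) \<and> E = T ` unit_ball I)"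

end

theory Submission
  imports Defs
begin

text \<open>The two inclusions pinch \<open>E\<close> along every elementary tensor of unit vectors.
  Write \<open>E = T B\<close> with \<open>B\<close> the unit ball, and let \<open>T\<^sup>t\<close> be the adjoint of \<open>T\<close>. Let \<open>z\<close> be a unit
  elementary tensor. The left inclusion gives \<open>z = T w\<close> with \<open>\<bar>w\<bar> \<le> 1\<close>. The right inclusion gives
  \<open>\<bar>\<langle>v, T\<^sup>t z\<rangle>\<bar> = \<bar>\<langle>T v, z\<rangle>\<bar> \<le> 1\<close> for every \<open>v\<close> in \<open>B\<close>, that is, \<open>\<bar>T\<^sup>t z\<bar> \<le> 1\<close>. But
  \<open>\<langle>w, T\<^sup>t z\<rangle> = \<langle>z, z\<rangle> = 1\<close>, so two vectors of length at most one have scalar product one. They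
  coincide, and hence \<open>T (T\<^sup>t z) = z\<close>. The unit elementary tensors span the tensor product
  (\<open>span_unit_tensors\<close>), so \<open>T T\<^sup>t\<close> is the identity. Thus \<open>T\<close> is orthogonal and \<open>T B = B\<close>.

  The argument depends on the tensors only through the facts that they have norm one and span
  the space; \<open>ellipsoid_eq_unit_ball\<close> is stated accordingly.\<close>

lemma dot_add_left: "dot I (x + y) z = dot I x z + dot I y z"
  by (simp add: dot_def distrib_right sum.distrib)

lemma dot_scaleR_left: "dot I (c *\<^sub>R x) z = c * dot I x z"
  by (simp add: dot_def sum_distrib_left mult.assoc)

lemma dot_commute: "dot I x y = dot I y x"
  by (simp add: dot_def mult.commute)

lemma dot_diff_left: "dot I (x - y) z = dot I x z - dot I y z"
  by (simp add: dot_def left_diff_distrib sum_subtractf)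

lemma dot_self_nonneg: "0 \<le> dot I x x"
  by (simp add: dot_def sum_nonneg)

lemma dot_self_eq_0:
  assumes "finite I" "x \<in> coord_space I" "dot I x x = 0"
  shows "x = 0"
proof
  fix i
  show "x i = 0 i"
    using assms by (cases "i \<in> I") (auto simp: coord_space_def dot_def sum_nonneg_eq_0_iff)
qed

lemma subspace_coord_space: "subspace (coord_space I)"
  by (auto simp: subspace_def coord_space_def)

lemma unit_ball_iff: "x \<in> unit_ball I \<longleftrightarrow> x \<in> coord_space I \<and> dot I x x \<le> 1"
  by (simp add: unit_ball_def)

lemma polar_iff: "y \<in> polar I C \<longleftrightarrow> y \<in> coord_space I \<and> (\<forall>x\<in>C. \<bar>dot I x y\<bar> \<le> 1)"
  by (simp add: polar_def SUP_le_iff)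

text \<open>One inclusion is the Cauchy-Schwarz inequality; for the other, a vector of the polar set is
  tested against its own normalisation.\<close>

lemma polar_unit_ball: "polar I (unit_ball I) = unit_ball I"
proof (intro set_eqI iffI)
  fix y assume y: "y \<in> polar I (unit_ball I)"
  have "dot I y y \<le> 1"
  proof (rule ccontr)
    assume "\<not> dot I y y \<le> 1"
    then have gt: "1 < dot I y y" by simp
    define v where "v = (1 / sqrt (dot I y y)) *\<^sub>R y"
    have "dot I v v = 1"
      using gt by (simp add: v_def dot_scaleR_left dot_commute[of I y "_ *\<^sub>R y"])
    moreover have "v \<in> coord_space I"
      using y by (simp add: v_def polar_iff subspace_coord_space subspace_scale)
    ultimately have "\<bar>dot I v y\<bar> \<le> 1"
      using y by (simp add: polar_iff unit_ball_iff)
    moreover have "dot I v y = sqrt (dot I y y)"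
      using gt by (simp add: v_def dot_scaleR_left real_div_sqrt)
    ultimately show False using gt by simp
  qed
  with y show "y \<in> unit_ball I" by (simp add: polar_iff unit_ball_iff)
next
  fix y assume y: "y \<in> unit_ball I"
  have "\<bar>dot I x y\<bar> \<le> 1" if "x \<in> unit_ball I" for x
  proof -
    have "(dot I x y)\<^sup>2 \<le> dot I x x * dot I y y"
      using Cauchy_Schwarz_ineq_sum[of x y I] by (simp add: dot_def power2_eq_square)
    also have "\<dots> \<le> 1 * 1"
      using that y by (intro mult_mono) (auto simp: unit_ball_iff dot_self_nonneg)
    finally show ?thesis by (simp add: abs_square_le_1)
  qed
  with y show "y \<in> polar I (unit_ball I)" by (simp add: polar_iff unit_ball_iff)
qed

text \<open>A linear map of the ambient function space has an adjoint with respect to \<open>dot I\<close>: its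
  coordinates are the scalar products with the images of the standard basis.\<close>

lemma adjoint_exists:
  assumes fin: "finite I" and T: "linear T"
  obtains A where "linear A" "range A \<subseteq> coord_space I"
    "\<And>v u. v \<in> coord_space I \<Longrightarrow> dot I (T v) u = dot I v (A u)"
proof
  define e :: "'a \<Rightarrow> 'a \<Rightarrow> real" where "e = (\<lambda>m n. if n = m then 1 else 0)"
  define A where "A = (\<lambda>u m. if m \<in> I then dot I (T (e m)) u else 0)"
  show "linear A"
    by (rule linearI)
      (auto simp: A_def fun_eq_iff dot_commute[of I "T _"] dot_add_left dot_scaleR_left)
  show "range A \<subseteq> coord_space I"
    by (auto simp: A_def coord_space_def)
  fix v u :: "'a \<Rightarrow> real"
  assume v: "v \<in> coord_space I"
  have sum_apply: "(\<Sum>m\<in>I. f m) n = (\<Sum>m\<in>I. f m n)" for f :: "'a \<Rightarrow> 'a \<Rightarrow> real" and n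
    using fin by (induction I rule: finite_induct) auto
  have "v = (\<Sum>m\<in>I. v m *\<^sub>R e m)"
  proof
    fix n
    have "(\<Sum>m\<in>I. v m *\<^sub>R e m) n = (\<Sum>m\<in>I. if n = m then v m else 0)"
      unfolding sum_apply by (rule sum.cong) (auto simp: e_def)
    also have "\<dots> = v n"
      using v fin by (simp add: coord_space_def)
    finally show "v n = (\<Sum>m\<in>I. v m *\<^sub>R e m) n" ..
  qed
  then have Tv: "T v = (\<Sum>m\<in>I. v m *\<^sub>R T (e m))"
    using linear_sum[OF T, of "\<lambda>m. v m *\<^sub>R e m" I] by (simp add: linear_scale[OF T])
  have "dot I (T v) u = (\<Sum>m\<in>I. v m * dot I (T (e m)) u)"
  proof -
    have "dot I (\<Sum>m\<in>J. f m) u = (\<Sum>m\<in>J. dot I (f m) u)"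
      for J :: "'a set" and f :: "'a \<Rightarrow> 'a \<Rightarrow> real"
      by (induction J rule: infinite_finite_induct) (simp_all add: dot_def distrib_right sum.distrib)
    then show ?thesis by (simp add: Tv dot_scaleR_left)
  qed
  also have "\<dots> = dot I v (A u)"
    unfolding dot_def[of I v] by (rule sum.cong) (auto simp: A_def)
  finally show "dot I (T v) u = dot I v (A u)" .
qed

text \<open>Each \<open>z\<close> in \<open>S\<close> is a common point of the boundaries of \<open>E\<close> and of the unit ball at which both
  bodies have the supporting hyperplane \<open>\<langle>z, y\<rangle> = 1\<close>. For the positive definite form that defines
  \<open>E\<close>, the common hyperplane makes \<open>z\<close> an eigenvector, and the common boundary point makes its
  eigenvalue one. A spanning set of such eigenvectors forces the form to be the scalar product.\<close>

lemma ellipsoid_eq_unit_ball: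
  assumes fin: "finite I" and E: "ellipsoid I E"
    and span: "span S = coord_space I"
    and unit: "\<And>z. z \<in> S \<Longrightarrow> dot I z z = 1"
    and mem: "S \<subseteq> E"
    and polar: "E \<subseteq> polar I S"
  shows "E = unit_ball I"
proof -
  obtain T where T: "linear T" and bij: "bij_betw T (coord_space I) (coord_space I)"
    and E_eq: "E = T ` unit_ball I"
    using E unfolding ellipsoid_def by blast
  obtain A where A: "linear A" and A_range: "range A \<subseteq> coord_space I"
    and adj: "\<And>v u. v \<in> coord_space I \<Longrightarrow> dot I (T v) u = dot I v (A u)"
    using adjoint_exists[OF fin T] by blast
  have A_coord: "A u \<in> coord_space I" for u
    using A_range by blast
  have TA_S: "T (A z) = z" if z: "z \<in> S" for z
  proof -
    obtain w where w: "w \<in> unit_ball I" "z = T w"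
      using mem z E_eq by blast
    have "\<bar>dot I v (A z)\<bar> \<le> 1" if v: "v \<in> unit_ball I" for v
    proof -
      have "T v \<in> polar I S" using v polar E_eq by blast
      then have "\<bar>dot I z (T v)\<bar> \<le> 1" using z by (simp add: polar_iff)
      then show ?thesis
        using v by (simp add: dot_commute[of I z] adj unit_ball_iff)
    qed
    then have "A z \<in> polar I (unit_ball I)"
      using A_coord by (simp add: polar_iff)
    then have A_le: "dot I (A z) (A z) \<le> 1"
      by (simp add: polar_unit_ball unit_ball_iff)
    have "dot I w (A z) = 1"
      using adj[of w z] w unit[OF z] by (simp add: unit_ball_iff)
    then have "dot I (w - A z) (w - A z) = dot I w w - 2 + dot I (A z) (A z)"
      by (simp add: dot_diff_left dot_commute[of I _ "w - A z"] dot_commute[of I "A z" w])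
    then have "dot I (w - A z) (w - A z) = 0"
      using w A_le dot_self_nonneg[of I "w - A z"] by (simp add: unit_ball_iff)
    then have "w - A z = 0"
      using w A_coord
      by (intro dot_self_eq_0[OF fin])
        (auto simp: unit_ball_iff intro: subspace_diff[OF subspace_coord_space])
    with w show ?thesis by simp
  qed
  have TA: "T (A u) = u" if "u \<in> coord_space I" for u
  proof -
    have "linear (T \<circ> A)" using A T by (rule linear_compose)
    then have "(T \<circ> A) u = id u"
      by (rule linear_eq_on_span[OF _ linear_id, where B = S]) (use TA_S that span in auto)
    then show ?thesis by simp
  qed
  have A_norm: "dot I (A u) (A u) = dot I u u" if "u \<in> coord_space I" for u
    using adj[OF A_coord, of u u] TA[OF that] by simp
  show ?thesis
  proof (intro set_eqI iffI)
    fix u assume "u \<in> E"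
    then obtain v where v: "v \<in> unit_ball I" "u = T v" using E_eq by blast
    have u: "u \<in> coord_space I"
      using bij v by (auto simp: bij_betw_def unit_ball_iff)
    have "A u = v"
      using bij v TA[OF u] A_coord
      by (auto simp: bij_betw_def unit_ball_iff dest: inj_onD)
    then show "u \<in> unit_ball I"
      using A_norm[OF u] u v by (simp add: unit_ball_iff)
  next
    fix u assume u: "u \<in> unit_ball I"
    then have "A u \<in> unit_ball I"
      using A_norm A_coord by (simp add: unit_ball_iff)
    moreover have "u = T (A u)" using u TA by (simp add: unit_ball_iff)
    ultimately show "u \<in> E" using E_eq by blast
  qed
qed

lemma tensor_scaleR:
  "tensor l d (\<lambda>i. c i *\<^sub>R x i) = (\<Prod>i<l. c i) *\<^sub>R tensor l d x"
  by (auto simp: tensor_def fun_eq_iff prod.distrib)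

text \<open>A tensor with no vanishing factor is a multiple of the tensor of the normalised factors,
  and any other elementary tensor is zero.\<close>

lemma span_unit_tensors:
  "span {tensor l d x | x. \<forall>i<l. x i \<in> coord_space {..<d i} \<and> dot {..<d i} (x i) (x i) = 1}
    = tensor_space l d" (is "span ?U = _")
proof
  have "?U \<subseteq> tensor_space l d"
    by (auto simp: tensor_def coord_space_def)
  then show "span ?U \<subseteq> tensor_space l d"
    by (rule span_minimal[OF _ subspace_coord_space])
  have "tensor l d x \<in> span ?U" if x: "\<forall>i<l. x i \<in> coord_space {..<d i}" for x
  proof -
    define r where "r = (\<lambda>i. sqrt (dot {..<d i} (x i) (x i)))"
    show ?thesis
    proof (cases "\<exists>i<l. r i = 0")
      case True
      then obtain i where i: "i < l" "x i = 0"
        using x dot_self_eq_0[of "{..<d _}"] by (auto simp: r_def)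
      then have "(\<Prod>i<l. x i (m i)) = 0" for m
        by (intro prod_zero) (auto intro!: bexI[of _ i])
      then have "tensor l d x = 0" by (auto simp: tensor_def)
      then show ?thesis by (simp add: span_zero)
    next
      case False
      define y where "y = (\<lambda>i. (1 / r i) *\<^sub>R x i)"
      have "y i \<in> coord_space {..<d i} \<and> dot {..<d i} (y i) (y i) = 1" if i: "i < l" for i
      proof
        show "y i \<in> coord_space {..<d i}"
          using x i by (simp add: y_def subspace_coord_space subspace_scale)
        have "dot {..<d i} (x i) (x i) = r i * r i"
          by (simp add: r_def dot_self_nonneg)
        moreover have "r i \<noteq> 0" using False i by blast
        ultimately show "dot {..<d i} (y i) (y i) = 1"
          by (simp add: y_def dot_scaleR_left dot_commute[of _ "x i" "_ *\<^sub>R x i"])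
      qed
      then have "tensor l d y \<in> ?U" by blast
      moreover have "tensor l d x = (\<Prod>i<l. r i) *\<^sub>R tensor l d y"
      proof -
        have "tensor l d y = (\<Prod>i<l. 1 / r i) *\<^sub>R tensor l d x"
          unfolding y_def by (rule tensor_scaleR)
        moreover have "(\<Prod>i<l. r i) * (\<Prod>i<l. 1 / r i) = 1"
          unfolding prod.distrib[symmetric] using False by (intro prod.neutral) auto
        ultimately show ?thesis by simp
      qed
      ultimately show ?thesis by (simp only: span_scale span_base)
    qed
  qed
  then have "span {tensor l d x | x. \<forall>i<l. x i \<in> coord_space {..<d i}} \<subseteq> span ?U"
    by (intro span_minimal) auto
  then show "tensor_space l d \<subseteq> span ?U"
    by (simp only: span_tensors)
qed

theorem theorem4p2:
  fixes l :: nat and d :: "nat \<Rightarrow> nat" and E :: "((nat \<Rightarrow> nat) \<Rightarrow> real) set"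
  assumes "l \<ge> 1"
    and "\<forall>i<l. d i \<ge> 1"
    and "ellipsoid (multi_indices l d) E"
    and "proj_prod l d (\<lambda>i. unit_ball {..<d i}) \<subseteq> E"
    and "E \<subseteq> inj_prod l d (\<lambda>i. unit_ball {..<d i})"
  shows "E = unit_ball (multi_indices l d)"
proof -
  let ?U = "{tensor l d x | x. \<forall>i<l. x i \<in> coord_space {..<d i} \<and> dot {..<d i} (x i) (x i) = 1}"
  have U_proj: "?U \<subseteq> proj_prod l d (\<lambda>i. unit_ball {..<d i})"
    unfolding proj_prod_def
    by (rule order_trans[OF _ hull_subset]) (fastforce simp: unit_ball_iff)
  show ?thesis
  proof (rule ellipsoid_eq_unit_ball[OF finite_multi_indices assms(3) span_unit_tensors])
    show "dot (multi_indices l d) z z = 1" if "z \<in> ?U" for z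
      using that by (auto simp: dot_tensor)
    show "?U \<subseteq> E" using U_proj assms(4) by blast
    \<comment> \<open>The unit balls are their own polars, so the injective product is the polar of the
      projective product of the same balls.\<close>
    have "E \<subseteq> polar (multi_indices l d) (proj_prod l d (\<lambda>i. unit_ball {..<d i}))"
      using assms(5) by (simp add: inj_prod_def polar_unit_ball)
    then show "E \<subseteq> polar (multi_indices l d) ?U"
      using U_proj by (auto simp only: polar_iff subset_iff)
  qed
qed

end
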